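(* Let $X\subset\mathbb{R}^n$ be open and let $u:X\to\mathbb{R}$ be a locally semiconvex function. Then for every measurable set $E\subset\mathrm{Diff}^2u$ one has $$|Du(E)|\leq\int_E|\det D^2u(x)|\,dx,$$ where $|\cdot|$ on the left denotes Lebesgue measure.
   Context: A function $u$ is $\lambda$-semiconvex ($\lambda\ge0$) on a convex set if $u+\frac{\lambda}{2}|\cdot|^2$ is convex there; $u$ is locally semiconvex on $X$ if every $x\in X$ belongs to some ball $B\subset X$ on which $u$ is $\lambda$-semiconvex for some $\lambda=\lambda(x)\ge0$. $\mathrm{Diff}^2u$ is the set of points $x\in X$ at which $u$ is twice differentiable in the Peano sense: $u(y)=u(x)+\langle q,y-x\rangle+\frac12\langle A(y-x),y-x\rangle+o(|y-x|^2)$ as $y\to x$ for some $q\in\mathbb{R}^n$ and symmetric matrix $A$; these are unique and $Du(x)=q$, $D^2u(x)=A$. $Du(E)=\{Du(x):x\in E\}$. *)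

theory Defs
  imports "HOL-Analysis.Analysis" "HOL-Library.Landau_Symbols"
begin

text \<open>
  A function on an open set \<open>X\<close> is represented by a total function of which only the values
  on \<open>X\<close> matter: for \<open>X\<close> open and \<open>x \<in> X\<close> the filter \<open>at x\<close> only sees points of \<open>X\<close>.
\<close>

definition semiconvex_on :: "real \<Rightarrow> (real ^ 'n) set \<Rightarrow> (real ^ 'n \<Rightarrow> real) \<Rightarrow> bool" where
  "semiconvex_on lam S u \<longleftrightarrow> 0 \<le> lam \<and> convex_on S (\<lambda>x. u x + lam / 2 * (norm x)\<^sup>2)"

definition locally_semiconvex_on :: "(real ^ 'n) set \<Rightarrow> (real ^ 'n \<Rightarrow> real) \<Rightarrow> bool" where
  "locally_semiconvex_on X u \<longleftrightarrow>
     (\<forall>x\<in>X. \<exists>c r lam. x \<in> ball c r \<and> ball c r \<subseteq> X \<and> semiconvex_on lam (ball c r) u)"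

definition has_peano_expansion ::
    "(real ^ 'n \<Rightarrow> real) \<Rightarrow> real ^ 'n \<Rightarrow> real ^ 'n \<Rightarrow> real ^ 'n ^ 'n \<Rightarrow> bool" where
  "has_peano_expansion u x q A \<longleftrightarrow> transpose A = A \<and>
     (\<lambda>y. u y - (u x + q \<bullet> (y - x) + 1 / 2 * ((A *v (y - x)) \<bullet> (y - x))))
       \<in> o[at x](\<lambda>y. (norm (y - x))\<^sup>2)"

definition Diff2 :: "(real ^ 'n) set \<Rightarrow> (real ^ 'n \<Rightarrow> real) \<Rightarrow> (real ^ 'n) set" where
  "Diff2 X u = {x \<in> X. \<exists>q A. has_peano_expansion u x q A}"

definition Du :: "(real ^ 'n \<Rightarrow> real) \<Rightarrow> real ^ 'n \<Rightarrow> real ^ 'n" where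
  "Du u x = (THE q. \<exists>A. has_peano_expansion u x q A)"

definition D2u :: "(real ^ 'n \<Rightarrow> real) \<Rightarrow> real ^ 'n \<Rightarrow> real ^ 'n ^ 'n" where
  "D2u u x = (THE A. \<exists>q. has_peano_expansion u x q A)"

lemma has_peano_expansion_unique:
  fixes u :: "real ^ 'n \<Rightarrow> real"
  assumes "has_peano_expansion u x q A" "has_peano_expansion u x q' A'"
  shows "q = q'" "A = A'"
proof -
  define p where "p = q' - q"
  define M where "M = A' - A"
  have sym: "transpose M = M"
    using assms unfolding M_def has_peano_expansion_def transpose_def
    by (simp add: vec_eq_iff)
  have o1: "(\<lambda>y. p \<bullet> (y - x) + 1 / 2 * ((M *v (y - x)) \<bullet> (y - x))) \<in> o[at x](\<lambda>y. (norm (y - x))\<^sup>2)"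
  proof -
    have "(\<lambda>y. (u y - (u x + q \<bullet> (y - x) + 1 / 2 * ((A *v (y - x)) \<bullet> (y - x))))
            - (u y - (u x + q' \<bullet> (y - x) + 1 / 2 * ((A' *v (y - x)) \<bullet> (y - x)))))
          \<in> o[at x](\<lambda>y. (norm (y - x))\<^sup>2)"
      by (rule sum_in_smallo(2)) (use assms in \<open>simp_all only: has_peano_expansion_def\<close>)
    moreover have "(\<lambda>y. (u y - (u x + q \<bullet> (y - x) + 1 / 2 * ((A *v (y - x)) \<bullet> (y - x))))
            - (u y - (u x + q' \<bullet> (y - x) + 1 / 2 * ((A' *v (y - x)) \<bullet> (y - x)))))
        = (\<lambda>y. p \<bullet> (y - x) + 1 / 2 * ((M *v (y - x)) \<bullet> (y - x)))"
      by (simp add: p_def M_def matrix_vector_mult_diff_rdistrib inner_diff_left algebra_simps fun_eq_iff)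
    ultimately show ?thesis by simp
  qed
  have key: "p \<bullet> v = 0 \<and> (M *v v) \<bullet> v = 0" if v: "v \<noteq> 0" for v
  proof -
    let ?a = "p \<bullet> v" and ?b = "1 / 2 * ((M *v v) \<bullet> v)"
    have fl: "filterlim (\<lambda>t::real. x + t *\<^sub>R v) (at x) (at 0)"
      by (rule filterlim_atI)
        (use v in \<open>auto intro!: tendsto_eq_intros simp: eventually_at_filter\<close>)
    have "(\<lambda>t. p \<bullet> (x + t *\<^sub>R v - x) + 1 / 2 * ((M *v (x + t *\<^sub>R v - x)) \<bullet> (x + t *\<^sub>R v - x)))
        \<in> o[at 0](\<lambda>t. (norm (x + t *\<^sub>R v - x))\<^sup>2)"
      by (rule landau_o.small.compose[OF o1 fl])
    moreover have "(\<lambda>t. p \<bullet> (x + t *\<^sub>R v - x) + 1 / 2 * ((M *v (x + t *\<^sub>R v - x)) \<bullet> (x + t *\<^sub>R v - x)))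
        = (\<lambda>t. t * ?a + t\<^sup>2 * ?b)"
      by (simp add: matrix_vector_mult_scaleR power2_eq_square mult_ac)
    moreover have "(\<lambda>t. (norm (x + t *\<^sub>R v - x))\<^sup>2) = (\<lambda>t. (norm v)\<^sup>2 * t\<^sup>2)"
      by (simp add: power_mult_distrib mult_ac)
    ultimately have "(\<lambda>t. t * ?a + t\<^sup>2 * ?b) \<in> o[at 0](\<lambda>t. (norm v)\<^sup>2 * t\<^sup>2)"
      by (simp only:)
    then have o2: "(\<lambda>t::real. t * ?a + t\<^sup>2 * ?b) \<in> o[at 0](\<lambda>t. t\<^sup>2)"
      using v by simp
    have L2: "((\<lambda>t::real. (t * ?a + t\<^sup>2 * ?b) / t\<^sup>2) \<longlongrightarrow> 0) (at 0)"
      by (rule smalloD_tendsto[OF o2])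
    have "((\<lambda>t::real. (t * ?a + t\<^sup>2 * ?b) / t\<^sup>2 * t) \<longlongrightarrow> 0 * 0) (at 0)"
      by (intro tendsto_intros L2)
    then have "((\<lambda>t::real. ?a + t * ?b) \<longlongrightarrow> 0) (at 0)"
      unfolding mult_zero_left
      by (rule Lim_transform_eventually)
        (auto simp: eventually_at_filter field_simps power2_eq_square)
    moreover have "((\<lambda>t::real. ?a + t * ?b) \<longlongrightarrow> ?a + 0 * ?b) (at 0)"
      by (intro tendsto_intros)
    ultimately have a0: "?a = 0"
      using LIM_unique by fastforce
    have "((\<lambda>t::real. ?b) \<longlongrightarrow> 0) (at 0)"
      using L2 by (rule Lim_transform_eventually) (auto simp: eventually_at_filter a0)
    then have "?b = 0"
      using LIM_const_eq by blast
    with a0 show ?thesis by simp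
  qed
  have "p = 0"
    using key[of p] by force
  then show "q = q'" by (simp add: p_def)
  have quad: "(M *v v) \<bullet> v = 0" for v
    using key[of v] by (cases "v = 0") auto
  have bil: "(M *v v) \<bullet> w = 0" for v w
  proof -
    have "(M *v w) \<bullet> v = (M *v v) \<bullet> w"
      using sym by (metis dot_lmul_matrix inner_commute transpose_matrix_vector)
    moreover have "(M *v (v + w)) \<bullet> (v + w) = (M *v v) \<bullet> v + (M *v w) \<bullet> w + (M *v v) \<bullet> w + (M *v w) \<bullet> v"
      by (simp add: matrix_vector_right_distrib inner_add_left inner_add_right)
    ultimately show ?thesis using quad by simp
  qed
  have "M *v v = 0" for v
    using bil[of v "M *v v"] by simp
  then have "M = 0"
    by (metis matrix_eq matrix_vector_mult_0)
  then show "A = A'" by (simp add: M_def)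
qed

lemma has_peano_expansion_imp:
  assumes "has_peano_expansion u x q A"
  shows "Du u x = q" "D2u u x = A"
  unfolding Du_def D2u_def
  using assms has_peano_expansion_unique by blast+

end

theory Submission imports Defs begin

text \<open>
  The inequality is the area inequality \<open>|f(E)| \<le> \<integral>\<^sub>E |det f'|\<close> for \<open>f = Du\<close>. The area inequality
  holds for every map on a measurable set \<open>E\<close> that is differentiable relative to \<open>E\<close> at each
  point of \<open>E\<close> (lemma \<open>emeasure_differentiable_image\<close>). So everything reduces to showing that \<open>Du\<close>, restricted to \<open>Diff2 X u\<close>, is differentiable with
  derivative \<open>D2u\<close> (lemma \<open>Du_has_derivative\<close>).
  
  For a general function a second-order Peano expansion at \<open>x\<close> says nothing about gradients at
  nearby points; semiconvexity supplies the missing link. Let \<open>q\<close>, \<open>A\<close> be the gradient and the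
  Hessian at \<open>x\<close>, and \<open>p\<close> the gradient at a nearby point \<open>y\<close>. Near \<open>x\<close> the paraboloid with
  gradient \<open>p\<close> and opening \<open>-lam\<close> touches \<open>u\<close> from below at \<open>y\<close>
  (lemma \<open>semiconvex_on_above_tangent\<close>), with the same \<open>lam\<close> for all \<open>y\<close>. On the other hand the
  expansion at \<open>x\<close> controls \<open>u\<close> both at \<open>y\<close> and at \<open>y + k\<close> up to \<open>o(|y - x|\<^sup>2 + |k|\<^sup>2)\<close>. If
  \<open>p\<close> deviated from \<open>q + A (y - x)\<close> by an amount comparable to \<open>|y - x|\<close>, then a step \<open>k\<close> in the
  direction of the deviation, of length a small multiple of \<open>|y - x|\<close>, would push the paraboloid
  above \<open>u\<close>. Hence \<open>p = q + A (y - x) + o(|y - x|)\<close> (lemma \<open>peano_gradient_first_order\<close>).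
\<close>

section \<open>Differentiability of the gradient at points of second-order expansion\<close>

lemma peano_remainder_bound:
  assumes "has_peano_expansion u x q A" "0 < e"
  shows "\<exists>d>0. \<forall>h. norm h < d \<longrightarrow>
    \<bar>u (x + h) - (u x + q \<bullet> h + 1 / 2 * ((A *v h) \<bullet> h))\<bar> \<le> e * (norm h)\<^sup>2"
proof -
  have "(\<lambda>y. u y - (u x + q \<bullet> (y - x) + 1 / 2 * ((A *v (y - x)) \<bullet> (y - x))))
       \<in> o[at x](\<lambda>y. (norm (y - x))\<^sup>2)"
    using assms(1) by (simp add: has_peano_expansion_def)
  from landau_o.smallD[OF this assms(2)] obtain d where "d > 0" and
    d: "\<And>y. y \<noteq> x \<Longrightarrow> dist y x < d \<Longrightarrow>
      \<bar>u y - (u x + q \<bullet> (y - x) + 1 / 2 * ((A *v (y - x)) \<bullet> (y - x)))\<bar> \<le> e * (norm (y - x))\<^sup>2"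
    unfolding eventually_at by auto
  have "\<bar>u (x + h) - (u x + q \<bullet> h + 1 / 2 * ((A *v h) \<bullet> h))\<bar> \<le> e * (norm h)\<^sup>2" if "norm h < d" for h
    using d[of "x + h"] that by (cases "h = 0") (auto simp: dist_norm)
  then show ?thesis using \<open>d > 0\<close> by blast
qed

lemma quadratic_form_bound:
  fixes A :: "real ^ 'n ^ 'n"
  obtains K where "0 \<le> K" "\<And>h. \<bar>(A *v h) \<bullet> h\<bar> \<le> K * (norm h)\<^sup>2"
proof -
  obtain K where K: "K > 0" "\<And>h. norm (A *v h) \<le> norm h * K"
    using bounded_linear.pos_bounded[OF matrix_vector_mul_bounded_linear] by blast
  have "\<bar>(A *v h) \<bullet> h\<bar> \<le> K * (norm h)\<^sup>2" for h
  proof -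
    have "\<bar>(A *v h) \<bullet> h\<bar> \<le> norm (A *v h) * norm h"
      by (rule Cauchy_Schwarz_ineq2)
    also have "\<dots> \<le> (norm h * K) * norm h"
      by (intro mult_right_mono K) auto
    finally show ?thesis by (simp add: power2_eq_square mult_ac)
  qed
  then show ?thesis using that[of K] K(1) by simp
qed

text \<open>
  Semiconvexity turns the local expansion at \<open>y\<close> into a global one-sided bound: along the
  segment from \<open>y\<close> to \<open>z\<close> the difference quotients of the convex function
  \<open>u + lam/2 |\<cdot>|\<^sup>2\<close> are monotone, so their value at \<open>z\<close> dominates their limit at \<open>y\<close>, which is
  given by \<open>p\<close>. The quadratic error has the same constant \<open>lam\<close> for all \<open>y\<close>, however large the
  Hessians \<open>B\<close> are, so the bound can be used at many points \<open>y\<close> simultaneously.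
\<close>

lemma semiconvex_on_above_tangent:
  assumes sc: "semiconvex_on lam S u" and y: "y \<in> S" and z: "z \<in> S"
    and pe: "has_peano_expansion u y p B"
  shows "u y + p \<bullet> (z - y) - lam / 2 * (norm (z - y))\<^sup>2 \<le> u z"
proof -
  define k where "k = z - y"
  obtain K where K: "0 \<le> K" "\<And>h. \<bar>(B *v h) \<bullet> h\<bar> \<le> K * (norm h)\<^sup>2"
    using quadratic_form_bound by blast
  obtain d where d: "d > 0" "\<And>h. norm h < d \<Longrightarrow>
      \<bar>u (y + h) - (u y + p \<bullet> h + 1 / 2 * ((B *v h) \<bullet> h))\<bar> \<le> 1 * (norm h)\<^sup>2"
    using peano_remainder_bound[OF pe, of 1] by auto
  define M where "M = (K / 2 + 1) * (norm k)\<^sup>2"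
  have "0 \<le> M" using K(1) by (simp add: M_def)
  have step: "p \<bullet> k - lam / 2 * (norm k)\<^sup>2 \<le> u z - u y + t * (M - lam / 2 * (norm k)\<^sup>2)"
    if t: "0 < t" "t < 1" "t * norm k < d" for t
  proof -
    have conv: "convex_on S (\<lambda>x. u x + lam / 2 * (norm x)\<^sup>2)"
      using sc by (simp add: semiconvex_on_def)
    have eq: "(1 - t) *\<^sub>R y + t *\<^sub>R z = y + t *\<^sub>R k"
      by (simp add: k_def algebra_simps)
    have conv_k: "u (y + t *\<^sub>R k) + lam / 2 * (norm (y + t *\<^sub>R k))\<^sup>2
        \<le> (1 - t) * (u y + lam / 2 * (norm y)\<^sup>2) + t * (u z + lam / 2 * (norm z)\<^sup>2)"
      using convex_onD[OF conv, of t y z] t y z unfolding eq by simp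
    \<comment> \<open>Expanding the square at the convex combination makes the error in the convexity inequality exactly quadratic.\<close>
    have norm_k: "(norm (y + t *\<^sub>R k))\<^sup>2 = (1 - t) * (norm y)\<^sup>2 + t * (norm z)\<^sup>2 - t * (1 - t) * (norm k)\<^sup>2"
      unfolding k_def power2_norm_eq_inner
      by (simp add: inner_add_left inner_add_right inner_diff_left inner_diff_right inner_commute algebra_simps)
    have up: "u (y + t *\<^sub>R k) \<le> u y + t * (u z - u y) + lam / 2 * (t * (1 - t) * (norm k)\<^sup>2)"
      using conv_k unfolding norm_k by (simp add: algebra_simps add_divide_distrib diff_divide_distrib)
    have nt: "norm (t *\<^sub>R k) = t * norm k" using t by simp
    have "\<bar>u (y + t *\<^sub>R k) - (u y + p \<bullet> (t *\<^sub>R k) + 1 / 2 * ((B *v (t *\<^sub>R k)) \<bullet> (t *\<^sub>R k)))\<bar> \<le> (t * norm k)\<^sup>2"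
      using d(2)[of "t *\<^sub>R k"] t nt by simp
    moreover have "\<bar>(B *v (t *\<^sub>R k)) \<bullet> (t *\<^sub>R k)\<bar> \<le> K * (t * norm k)\<^sup>2"
      using K(2)[of "t *\<^sub>R k"] unfolding nt .
    moreover have "p \<bullet> (t *\<^sub>R k) = t * (p \<bullet> k)" by simp
    ultimately have "u y + t * (p \<bullet> k) - (K / 2 + 1) * (t * norm k)\<^sup>2 \<le> u (y + t *\<^sub>R k)"
      unfolding distrib_right by linarith
    moreover have "(K / 2 + 1) * (t * norm k)\<^sup>2 = t * (t * M)"
      by (simp add: M_def power_mult_distrib power2_eq_square)
    ultimately have "t * (p \<bullet> k) \<le> t * (u z - u y + lam / 2 * ((1 - t) * (norm k)\<^sup>2) + t * M)"
      using up by (simp add: algebra_simps)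
    then have "p \<bullet> k \<le> u z - u y + lam / 2 * ((1 - t) * (norm k)\<^sup>2) + t * M"
      using t(1) by simp
    then show ?thesis by (simp add: algebra_simps)
  qed
  have "((\<lambda>t. u z - u y + t * (M - lam / 2 * (norm k)\<^sup>2)) \<longlongrightarrow> u z - u y + 0 * (M - lam / 2 * (norm k)\<^sup>2)) (at_right 0)"
    by (intro tendsto_intros)
  moreover have "\<forall>\<^sub>F t in at_right 0. p \<bullet> k - lam / 2 * (norm k)\<^sup>2 \<le> u z - u y + t * (M - lam / 2 * (norm k)\<^sup>2)"
  proof -
    define b where "b = min 1 (d / (norm k + 1))"
    have b: "b > 0" using d(1) by (simp add: b_def add_nonneg_pos)
    have "t * norm k < d" if "0 < t" "t < b" for t
    proof -
      have "t * (norm k + 1) < d"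
        using that by (simp add: b_def pos_less_divide_eq add_nonneg_pos)
      then show ?thesis using that by (simp add: algebra_simps)
    qed
    then show ?thesis
      by (intro eventually_at_rightI[OF step b]) (auto simp: b_def)
  qed
  ultimately have "p \<bullet> k - lam / 2 * (norm k)\<^sup>2 \<le> u z - u y"
    using tendsto_lowerbound[of _ _ "at_right (0::real)"] by (force simp: trivial_limit_at_right_real)
  then show ?thesis by (simp add: k_def)
qed

text \<open>
  The second-order expansion of \<open>u\<close> at the single point \<open>x\<close> forces a first-order expansion of
  the gradients at nearby points. With \<open>h = y - x\<close> and the gradient error
  \<open>v = p - q - A h\<close>, compare \<open>u (y + k) - u y\<close> computed from the expansion at \<open>x\<close> with the
  tangent bound at \<open>y\<close>. This gives \<open>v \<bullet> k \<le> (K/2 + lam/2) |k|\<^sup>2\<close> up to two remainders, of size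
  \<open>\<epsilon> |h + k|\<^sup>2\<close> and \<open>\<epsilon> |h|\<^sup>2\<close>. Taking \<open>k\<close> in the direction of \<open>v\<close> with \<open>|k| = s |h|\<close> and
  \<open>\<epsilon> = s\<^sup>2\<close> makes every term of order \<open>(s |h|)\<^sup>2\<close>; division by \<open>s |h|\<close> leaves
  \<open>|v| \<le> C s |h|\<close>, and \<open>s\<close> is as small as desired.
\<close>

lemma peano_gradient_first_order:
  assumes sc: "semiconvex_on lam (ball c r) u" and x: "x \<in> ball c r"
    and pe: "has_peano_expansion u x q A" and e: "0 < e"
  shows "\<exists>d>0. \<forall>y p B. norm (y - x) < d \<longrightarrow> has_peano_expansion u y p B \<longrightarrow>
    norm (p - q - A *v (y - x)) \<le> e * norm (y - x)"
proof -
  have lam: "0 \<le> lam" using sc by (simp add: semiconvex_on_def)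
  have sym: "(A *v a) \<bullet> b = (A *v b) \<bullet> a" for a b
    using pe by (metis has_peano_expansion_def dot_lmul_matrix inner_commute transpose_matrix_vector)
  obtain K where K: "0 \<le> K" "\<And>h. \<bar>(A *v h) \<bullet> h\<bar> \<le> K * (norm h)\<^sup>2"
    using quadratic_form_bound by blast
  \<comment> \<open>The 5 collects the two remainders: 4 from the point \<open>y + k\<close>, since \<open>|h + k| \<le> 2 |h|\<close>, and 1 from \<open>y\<close>.\<close>
  define C where "C = K / 2 + lam / 2 + 5"
  have C: "C > 0" using K(1) lam by (simp add: C_def)
  define s where "s = min 1 (e / C)"
  have s: "0 < s" "s \<le> 1" "C * s \<le> e"
    using C e by (auto simp: s_def min_def field_simps)
  obtain d1 where d1: "d1 > 0" "\<And>h. norm h < d1 \<Longrightarrow>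
      \<bar>u (x + h) - (u x + q \<bullet> h + 1 / 2 * ((A *v h) \<bullet> h))\<bar> \<le> s\<^sup>2 * (norm h)\<^sup>2"
    using peano_remainder_bound[OF pe, of "s\<^sup>2"] s by auto
  obtain d2 where d2: "d2 > 0" "ball x d2 \<subseteq> ball c r"
    using x open_ball open_contains_ball by blast
  \<comment> \<open>Half of the smaller radius, so that \<open>y + k\<close> stays inside both balls.\<close>
  define d where "d = min d1 d2 / 2"
  have "norm (p - q - A *v (y - x)) \<le> e * norm (y - x)"
    if yd: "norm (y - x) < d" and py: "has_peano_expansion u y p B" for y p B
  proof -
    define h where "h = y - x"
    define v where "v = p - q - A *v h"
    show ?thesis
    proof (cases "v = 0 \<or> h = 0")
      case True
      then show ?thesis
      proof
        assume "v = 0"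
        then show ?thesis using e by (simp add: v_def h_def)
      next
        assume "h = 0"
        then have "y = x" by (simp add: h_def)
        then have "p = q" using has_peano_expansion_unique(1)[OF pe] py by blast
        then show ?thesis using \<open>y = x\<close> by simp
      qed
    next
      case False
      define N where "N = norm h"
      have N: "N > 0" using False by (simp add: N_def)
      define k where "k = (s * N / norm v) *\<^sub>R v"
      have nk: "norm k = s * N" using False N s by (simp add: k_def)
      have vk: "v \<bullet> k = s * N * norm v"
        using False by (simp add: k_def power2_norm_eq_inner[symmetric] power2_eq_square)
      have nhk: "norm (h + k) \<le> 2 * N"
        using norm_triangle_ineq[of h k] nk s N
        by (smt (verit, best) N_def mult_left_le_one_le)
      have Nd: "2 * N < d1" "2 * N < d2" using yd by (auto simp: d_def N_def h_def)
      have yb: "y \<in> ball c r"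
        proof -
        have "norm (y - x) < d2" using Nd(2) N unfolding N_def h_def by linarith
        then show ?thesis
          by (intro subsetD[OF d2(2)]) (simp add: dist_norm norm_minus_commute)
      qed
      have zb: "x + (h + k) \<in> ball c r"
        using Nd nhk by (intro subsetD[OF d2(2)]) (simp add: dist_norm flip: norm_minus_cancel[of "h + k"])
      have tangent: "p \<bullet> k - lam / 2 * (s * N)\<^sup>2 \<le> u (x + (h + k)) - u (x + h)"
        using semiconvex_on_above_tangent[OF sc yb zb py] nk by (simp add: h_def algebra_simps)
      have "s\<^sup>2 * (norm (h + k))\<^sup>2 \<le> s\<^sup>2 * (2 * N)\<^sup>2"
        using nhk by (intro mult_left_mono power_mono) auto
      then have "\<bar>u (x + (h + k)) - (u x + q \<bullet> (h + k) + 1 / 2 * ((A *v (h + k)) \<bullet> (h + k)))\<bar> \<le> s\<^sup>2 * (2 * N)\<^sup>2"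
        using d1(2)[of "h + k"] Nd nhk by linarith
      then have R1: "\<bar>u (x + (h + k)) - (u x + q \<bullet> (h + k) + 1 / 2 * ((A *v (h + k)) \<bullet> (h + k)))\<bar> \<le> 4 * (s * N)\<^sup>2"
        by (simp add: power_mult_distrib)
      have R2: "\<bar>u (x + h) - (u x + q \<bullet> h + 1 / 2 * ((A *v h) \<bullet> h))\<bar> \<le> (s * N)\<^sup>2"
      proof -
        have "norm h < d1" using Nd(1) N unfolding N_def by linarith
        then show ?thesis using d1(2)[of h] by (simp add: N_def power_mult_distrib)
      qed
      have "(A *v (h + k)) \<bullet> (h + k) = (A *v h) \<bullet> h + 2 * ((A *v h) \<bullet> k) + (A *v k) \<bullet> k"
        using sym[of k h] by (simp add: matrix_vector_right_distrib inner_add_left inner_add_right)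
      moreover have "\<bar>(A *v k) \<bullet> k\<bar> \<le> K * (s * N)\<^sup>2"
        using K(2)[of k] nk by simp
      moreover have "v \<bullet> k = p \<bullet> k - q \<bullet> k - (A *v h) \<bullet> k"
        by (simp add: v_def inner_diff_left)
      moreover have "q \<bullet> (h + k) = q \<bullet> h + q \<bullet> k" by (simp add: inner_add_right)
      moreover have "C * (s * N)\<^sup>2 = 1 / 2 * (K * (s * N)\<^sup>2) + lam / 2 * (s * N)\<^sup>2 + 5 * (s * N)\<^sup>2"
        by (simp add: C_def algebra_simps)
      ultimately have "v \<bullet> k \<le> C * (s * N)\<^sup>2"
        using tangent R1 R2 by linarith
      then have "(s * N) * norm v \<le> (s * N) * (C * s * N)"
        unfolding vk by (simp add: power2_eq_square mult_ac)
      then have "norm v \<le> C * s * N"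
        using s(1) N by simp
      also have "\<dots> \<le> e * N"
        using s(3) N by simp
      finally show ?thesis by (simp add: v_def N_def h_def)
    qed
  qed
  moreover have "d > 0" using d1 d2 by (simp add: d_def)
  ultimately show ?thesis by blast
qed

text \<open>
  The derivative is taken relative to \<open>E\<close>, because \<open>Du\<close> is the gradient only on
  \<open>Diff2 X u\<close>, a set that need not be open.
\<close>

proposition Du_has_derivative:
  assumes sc: "locally_semiconvex_on X u" and E: "E \<subseteq> Diff2 X u" and x: "x \<in> E"
  shows "(Du u has_derivative (*v) (D2u u x)) (at x within E)"
proof -
  have peano: "has_peano_expansion u y (Du u y) (D2u u y)" if y: "y \<in> E" for y
  proof -
    obtain p B where "has_peano_expansion u y p B"
      using E y by (auto simp: Diff2_def)
    then show ?thesis using has_peano_expansion_imp by metis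
  qed
  have "x \<in> X" using E x by (auto simp: Diff2_def)
  then obtain c r lam where ball: "x \<in> ball c r" and semi: "semiconvex_on lam (ball c r) u"
    using sc by (auto simp: locally_semiconvex_on_def)
  have "\<exists>d>0. \<forall>y\<in>E. norm (y - x) < d \<longrightarrow>
      norm (Du u y - Du u x - D2u u x *v (y - x)) \<le> e * norm (y - x)" if "e > 0" for e
    using peano_gradient_first_order[OF semi ball peano[OF x] that] peano by blast
  then show ?thesis
    by (simp add: has_derivative_within_alt matrix_vector_mul_bounded_linear)
qed

section \<open>The area inequality for differentiable maps\<close>

text \<open>
  A copy of \<open>'a\<close> that carries the order pulled back from an enumeration by natural numbers. The
  theorems \<open>measure_differentiable_image\<close> and \<open>borel_measurable_det_Jacobian\<close> concern index types of
  class \<^class>\<open>wellorder\<close>. Renaming the coordinates by elements of the copy changes neither Lebesgue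
  measure nor determinants, and so carries these theorems over to arbitrary finite index types.
\<close>

typedef 'a enumerated = "UNIV :: 'a set" ..

instance enumerated :: (finite) finite
proof
  show "finite (UNIV :: 'a enumerated set)"
    by (rule inj_on_finite[of Rep_enumerated _ UNIV]) (simp_all add: inj_on_def Rep_enumerated_inject)
qed

instantiation enumerated :: (countable) wellorder
begin

definition less_eq_enumerated :: "'a enumerated \<Rightarrow> 'a enumerated \<Rightarrow> bool" where
  "less_eq_enumerated x y \<longleftrightarrow> to_nat (Rep_enumerated x) \<le> to_nat (Rep_enumerated y)"

definition less_enumerated :: "'a enumerated \<Rightarrow> 'a enumerated \<Rightarrow> bool" where
  "less_enumerated x y \<longleftrightarrow> to_nat (Rep_enumerated x) < to_nat (Rep_enumerated y)"

instance
proof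
  fix P :: "'a enumerated \<Rightarrow> bool" and a
  assume step: "\<And>x. (\<And>y. y < x \<Longrightarrow> P y) \<Longrightarrow> P x"
  show "P a"
  proof (induction a rule: measure_induct_rule[where f = "\<lambda>x. to_nat (Rep_enumerated x)"])
    case (less x)
    show ?case by (rule step, rule less.IH) (simp only: less_enumerated_def)
  qed
qed (auto simp: less_eq_enumerated_def less_enumerated_def Rep_enumerated_inject)

end

lemma bij_Rep_enumerated: "bij Rep_enumerated"
  by (rule o_bij[of Abs_enumerated]) (simp_all add: fun_eq_iff Abs_enumerated_inverse Rep_enumerated_inverse)

definition reindex :: "('m \<Rightarrow> 'n) \<Rightarrow> real ^ 'n \<Rightarrow> real ^ 'm" where
  "reindex \<sigma> x = (\<chi> i. x $ \<sigma> i)"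

lemma reindex_reindex_inv:
  assumes "bij \<sigma>"
  shows "reindex \<sigma> (reindex (inv \<sigma>) y) = y" "reindex (inv \<sigma>) (reindex \<sigma> x) = x"
  using assms by (simp_all add: reindex_def vec_eq_iff bij_is_inj bij_is_surj surj_f_inv_f)

lemma bounded_linear_reindex: "bounded_linear (reindex \<sigma>)"
  unfolding linear_conv_bounded_linear[symmetric]
  by (rule linearI) (simp_all add: reindex_def vec_eq_iff)

lemma prod_Basis_cart:
  "(\<Prod>b\<in>Basis. (x :: real ^ 'n) \<bullet> b) = (\<Prod>i\<in>UNIV. x $ i)"
  by (simp add: Basis_vec_def inner_axis axis_eq_axis prod.UNION_disjoint)

text \<open>
  A renaming of the coordinates maps boxes to boxes with permuted side lengths, and boxes
  determine Lebesgue measure.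
\<close>

lemma distr_lborel_reindex:
  fixes \<sigma> :: "'m::finite \<Rightarrow> 'n::finite"
  assumes \<sigma>: "bij \<sigma>"
  shows "distr lborel borel (reindex \<sigma>) = lborel"
proof (rule lborel_eqI[symmetric])
  fix l w :: "real ^ 'm"
  assume le: "\<And>b. b \<in> Basis \<Longrightarrow> l \<bullet> b \<le> w \<bullet> b"
  have [measurable]: "reindex \<sigma> \<in> borel \<rightarrow>\<^sub>M borel"
    by (intro borel_measurable_continuous_onI linear_continuous_on bounded_linear_reindex)
  let ?l = "reindex (inv \<sigma>) l" and ?w = "reindex (inv \<sigma>) w"
  have inv: "inv \<sigma> (\<sigma> i) = i" "\<sigma> (inv \<sigma> j) = j" for i j
    using \<sigma> by (simp_all add: bij_is_inj bij_is_surj surj_f_inv_f)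
  \<comment> \<open>A condition linking matching coordinates can be read from either index type.\<close>
  have all_swap: "(\<forall>i. R i (\<sigma> i)) \<longleftrightarrow> (\<forall>j. R (inv \<sigma> j) j)" for R
  proof (intro iffI allI)
    show "R (inv \<sigma> j) j" if "\<forall>i. R i (\<sigma> i)" for j
      using spec[OF that, of "inv \<sigma> j"] by (simp only: inv)
    show "R i (\<sigma> i)" if "\<forall>j. R (inv \<sigma> j) j" for i
      using spec[OF that, of "\<sigma> i"] by (simp only: inv)
  qed
  have vimage: "reindex \<sigma> -` box l w = box ?l ?w"
  proof (rule set_eqI)
    fix x
    show "x \<in> reindex \<sigma> -` box l w \<longleftrightarrow> x \<in> box ?l ?w"
      using all_swap[of "\<lambda>i j. l $ i < x $ j \<and> x $ j < w $ i"]
      by (simp add: mem_box_cart reindex_def)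
  qed
  have "l $ i \<le> w $ i" for i
    using le[of "axis i 1"] by (simp add: inner_axis axis_in_Basis_iff)
  then have le': "?l \<bullet> b \<le> ?w \<bullet> b" if "b \<in> Basis" for b
    using that by (auto simp: Basis_vec_def reindex_def inner_axis)
  have "emeasure (distr lborel borel (reindex \<sigma>)) (box l w) = ennreal (\<Prod>j\<in>UNIV. (?w - ?l) $ j)"
    using le' by (simp add: emeasure_distr vimage prod_Basis_cart)
  also have "(\<Prod>j\<in>UNIV. (?w - ?l) $ j) = (\<Prod>i\<in>UNIV. (w - l) $ i)"
    using prod.reindex_bij_betw[OF bij_imp_bij_inv[OF \<sigma>], of "\<lambda>i. (w - l) $ i"]
    by (simp add: reindex_def)
  finally show "emeasure (distr lborel borel (reindex \<sigma>)) (box l w) = ennreal (\<Prod>b\<in>Basis. (w - l) \<bullet> b)"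
    by (simp add: prod_Basis_cart)
qed simp

text \<open>
  The transition to the completion needs that null sets are preserved in both directions, which
  follows from the equality of the Borel measures.
\<close>

lemma reindex_preserves_lebesgue:
  fixes \<sigma> :: "'m::finite \<Rightarrow> 'n::finite"
  assumes \<sigma>: "bij \<sigma>"
  shows "reindex \<sigma> \<in> lebesgue \<rightarrow>\<^sub>M lebesgue" "distr lebesgue lebesgue (reindex \<sigma>) = lebesgue"
proof -
  have [measurable]: "reindex \<sigma> \<in> borel \<rightarrow>\<^sub>M borel"
    by (intro borel_measurable_continuous_onI linear_continuous_on bounded_linear_reindex)
  have m: "reindex \<sigma> \<in> lebesgue \<rightarrow>\<^sub>M lborel"
    by (simp add: measurable_completion)
  have eq: "distr lebesgue lborel (reindex \<sigma>) = lborel"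
    using distr_lborel_reindex[OF \<sigma>] by (simp add: distr_completion cong: distr_cong)
  show "reindex \<sigma> \<in> lebesgue \<rightarrow>\<^sub>M lebesgue"
    by (rule completion.measurable_completion2[OF m]) (simp add: eq)
  show "distr lebesgue lebesgue (reindex \<sigma>) = lebesgue"
    using completion.completion_distr_eq[OF m] by (simp add: eq)
qed

text \<open>
  Conjugation with \<open>\<sigma>\<close> is a sign-preserving bijection between the permutations of the two index
  types, and it matches the Leibniz expansions term by term.
\<close>

lemma det_reindex:
  fixes A :: "real ^ 'n ^ 'n" and \<sigma> :: "'m::finite \<Rightarrow> 'n::finite"
  assumes \<sigma>: "bij \<sigma>"
  shows "det (\<chi> i j. A $ \<sigma> i $ \<sigma> j) = det A"
proof -
  let ?\<phi> = "map_permutation UNIV \<sigma>"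
  have inj: "inj \<sigma>" and \<sigma>': "bij_betw \<sigma> UNIV UNIV" using \<sigma> by (auto simp: bij_is_inj)
  have bij: "bij_betw ?\<phi> {p. p permutes UNIV} {p. p permutes UNIV}"
  proof (rule bij_betw_byWitness[where f' = "map_permutation UNIV (inv \<sigma>)"])
    show "\<forall>p\<in>{p. p permutes UNIV}. map_permutation UNIV (inv \<sigma>) (?\<phi> p) = p"
      using \<sigma>' inj by (auto intro!: map_permutation_compose_inv)
    show "\<forall>p\<in>{p. p permutes UNIV}. ?\<phi> (map_permutation UNIV (inv \<sigma>) p) = p"
      using bij_imp_bij_inv[OF \<sigma>] \<sigma>
      by (auto intro!: map_permutation_compose_inv simp: bij_is_surj surj_f_inv_f)
  qed (use \<sigma>' bij_imp_bij_inv[OF \<sigma>] in \<open>auto intro: map_permutation_permutes\<close>)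
  have "det A = (\<Sum>p | p permutes UNIV. of_int (sign (?\<phi> p)) * (\<Prod>i\<in>UNIV. A $ i $ ?\<phi> p i))"
    unfolding det_def using sum.reindex_bij_betw[OF bij, of "\<lambda>p. of_int (sign p) * (\<Prod>i\<in>UNIV. A $ i $ p i)"]
    by simp
  also have "\<dots> = (\<Sum>p | p permutes UNIV. of_int (sign p) * (\<Prod>i\<in>UNIV. A $ \<sigma> i $ \<sigma> (p i)))"
  proof (intro sum.cong refl arg_cong2[where f = "(*)"])
    fix p :: "'m \<Rightarrow> 'm" assume p: "p \<in> {p. p permutes UNIV}"
    show "real_of_int (sign (?\<phi> p)) = of_int (sign p)"
      using p inj by (simp add: sign_map_permutation)
    show "(\<Prod>i\<in>UNIV. A $ i $ ?\<phi> p i) = (\<Prod>i\<in>UNIV. A $ \<sigma> i $ \<sigma> (p i))"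
      using prod.reindex_bij_betw[OF \<sigma>, of "\<lambda>i. A $ i $ ?\<phi> p i"] inj
      by (simp add: map_permutation_apply)
  qed
  finally show ?thesis by (simp add: det_def)
qed

lemma matrix_reindex_conj:
  fixes \<sigma> :: "'m::finite \<Rightarrow> 'n::finite"
  assumes \<sigma>: "bij \<sigma>"
  shows "matrix (\<lambda>y. reindex \<sigma> (f (reindex (inv \<sigma>) y))) = (\<chi> i j. matrix f $ \<sigma> i $ \<sigma> j)"
proof -
  have "reindex (inv \<sigma>) (axis j 1) = axis (\<sigma> j) 1" for j
    using \<sigma> by (auto simp: reindex_def axis_def vec_eq_iff bij_is_inj bij_is_surj surj_f_inv_f)
  then show ?thesis
    by (simp add: matrix_def reindex_def vec_eq_iff)
qed

text \<open>
  If the Jacobian is not integrable, then the right-hand side is infinite, so only the integrable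
  case is left, in which the estimate is known for Henstock-Kurzweil integrals.
\<close>

lemma emeasure_differentiable_image_wellorder:
  fixes f :: "real ^ 'n::{finite,wellorder} \<Rightarrow> real ^ 'n::_"
  assumes S: "S \<in> sets lebesgue"
    and deriv: "\<And>x. x \<in> S \<Longrightarrow> (f has_derivative f' x) (at x within S)"
  shows "emeasure lebesgue (f ` S) \<le> (\<integral>\<^sup>+x\<in>S. ennreal \<bar>det (matrix (f' x))\<bar> \<partial>lebesgue)"
proof -
  let ?J = "\<lambda>x. \<bar>det (matrix (f' x))\<bar>"
  have nn: "(\<integral>\<^sup>+x\<in>S. ennreal (?J x) \<partial>lebesgue) = (\<integral>\<^sup>+x. ennreal (?J x) \<partial>lebesgue_on S)"
    using S by (simp add: nn_integral_restrict_space)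
  show ?thesis
  proof (cases "(\<integral>\<^sup>+x. ennreal (?J x) \<partial>lebesgue_on S) = \<infinity>")
    case True
    then show ?thesis by (simp add: nn)
  next
    case False
    have int: "integrable (lebesgue_on S) ?J"
      using False borel_measurable_det_Jacobian[OF S deriv]
      by (intro integrableI_bounded) (auto simp: less_top)
    have int': "?J integrable_on S"
      using int S by (rule integrable_on_lebesgue_on)
    have "emeasure lebesgue (f ` S) = ennreal (measure lebesgue (f ` S))"
      using measurable_differentiable_image[OF S deriv int'] by (simp add: emeasure_eq_measure2)
    also have "\<dots> \<le> ennreal (integral S ?J)"
      by (intro ennreal_leI measure_differentiable_image[OF S deriv int'])
    also have "integral S ?J = (LINT x|lebesgue_on S. ?J x)"
      using lebesgue_integral_eq_integral[OF int S] by simp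
    also have "ennreal \<dots> = (\<integral>\<^sup>+x. ennreal (?J x) \<partial>lebesgue_on S)"
      using nn_integral_eq_integral[OF int] by simp
    finally show ?thesis by (simp add: nn)
  qed
qed

text \<open>
  The map \<open>f\<close> is conjugated with a renaming of coordinates to a well-ordered index type. Both
  \<open>S\<close> and its image keep their measure, the Jacobian keeps its values, and the integral is
  transported back by change of variables along the measure-preserving renaming.
\<close>

proposition emeasure_differentiable_image:
  fixes f :: "real ^ 'n \<Rightarrow> real ^ 'n"
  assumes S: "S \<in> sets lebesgue"
    and deriv: "\<And>x. x \<in> S \<Longrightarrow> (f has_derivative f' x) (at x within S)"
  shows "emeasure lebesgue (f ` S) \<le> (\<integral>\<^sup>+x\<in>S. ennreal \<bar>det (matrix (f' x))\<bar> \<partial>lebesgue)"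
proof -
  define \<sigma> :: "'n enumerated \<Rightarrow> 'n" where "\<sigma> = Rep_enumerated"
  have \<sigma>: "bij \<sigma>" unfolding \<sigma>_def by (rule bij_Rep_enumerated)
  let ?P = "reindex \<sigma>" and ?Q = "reindex (inv \<sigma>)"
  note PQ = reindex_reindex_inv[OF \<sigma>]
  note P = reindex_preserves_lebesgue[OF \<sigma>] and Q = reindex_preserves_lebesgue[OF bij_imp_bij_inv[OF \<sigma>]]
  have image: "?P ` T = ?Q -` T" for T
  proof (intro equalityI subsetI)
    fix y assume "y \<in> ?Q -` T"
    then show "y \<in> ?P ` T"
      using PQ(1)[of y] by (intro image_eqI[of _ _ "?Q y"]) auto
  qed (auto simp: PQ)
  have sets: "?P ` T \<in> sets lebesgue" if "T \<in> sets lebesgue" for T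
    using measurable_sets[OF Q(1) that] by (simp add: image)
  have em: "emeasure lebesgue (?P ` T) = emeasure lebesgue T" if "T \<in> sets lebesgue" for T
    using emeasure_distr[OF Q(1) that] by (simp add: Q(2) image)
  define g where "g y = ?P (f (?Q y))" for y
  define g' where "g' y z = ?P (f' (?Q y) (?Q z))" for y z
  have gd: "(g has_derivative g' y) (at y within ?P ` S)" if y: "y \<in> ?P ` S" for y
  proof -
    have QS: "?Q ` ?P ` S = S" by (simp add: image_image PQ)
    have "(?Q has_derivative ?Q) (at y within ?P ` S)"
      by (rule bounded_linear_imp_has_derivative[OF bounded_linear_reindex])
    moreover have "(f has_derivative f' (?Q y)) (at (?Q y) within ?Q ` ?P ` S)"
      unfolding QS using y by (intro deriv) (auto simp: PQ)
    ultimately have "((\<lambda>y. f (?Q y)) has_derivative (\<lambda>z. f' (?Q y) (?Q z))) (at y within ?P ` S)"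
      by (rule has_derivative_in_compose)
    then show ?thesis
      unfolding g_def g'_def by (rule bounded_linear.has_derivative[OF bounded_linear_reindex])
  qed
  have det: "det (matrix (g' y)) = det (matrix (f' (?Q y)))" for y
    unfolding g'_def matrix_reindex_conj[OF \<sigma>, of "f' (?Q y)"] by (rule det_reindex[OF \<sigma>])
  have "f differentiable_on S"
    using deriv by (auto simp: differentiable_on_def differentiable_def)
  then have fS: "f ` S \<in> sets lebesgue"
    using S by (intro differentiable_image_in_sets_lebesgue) auto
  have "(\<lambda>y. det (matrix (g' y))) \<in> borel_measurable (lebesgue_on (?P ` S))"
    by (rule borel_measurable_det_Jacobian[OF sets[OF S] gd])
  then have "(\<lambda>y. ennreal \<bar>det (matrix (g' y))\<bar>) \<in> borel_measurable (lebesgue_on (?P ` S))"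
    by measurable
  then have meas: "(\<lambda>y. ennreal \<bar>det (matrix (g' y))\<bar> * indicator (?P ` S) y) \<in> borel_measurable lebesgue"
    using sets[OF S] by (subst (asm) borel_measurable_restrict_space_iff_ennreal) auto
  have "emeasure lebesgue (f ` S) = emeasure lebesgue (g ` ?P ` S)"
    using em[OF fS] by (simp add: g_def image_image PQ)
  also have "\<dots> \<le> (\<integral>\<^sup>+y\<in>?P ` S. ennreal \<bar>det (matrix (g' y))\<bar> \<partial>lebesgue)"
    by (rule emeasure_differentiable_image_wellorder[OF sets[OF S] gd])
  also have "\<dots> = (\<integral>\<^sup>+y\<in>?P ` S. ennreal \<bar>det (matrix (g' y))\<bar> \<partial>distr lebesgue lebesgue ?P)"
    by (simp only: P(2))
  also have "\<dots> = (\<integral>\<^sup>+x. ennreal \<bar>det (matrix (g' (?P x)))\<bar> * indicator (?P ` S) (?P x) \<partial>lebesgue)"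
    by (rule nn_integral_distr[OF P(1)]) (simp only: P(2) meas)
  also have "\<dots> = (\<integral>\<^sup>+x\<in>S. ennreal \<bar>det (matrix (f' x))\<bar> \<partial>lebesgue)"
    
  proof -
    have "?P x \<in> ?P ` S \<longleftrightarrow> x \<in> S" for x
      by (simp add: image PQ)
    then show ?thesis by (simp add: det PQ indicator_def)
  qed
  finally show ?thesis .
qed

section \<open>The measure of the gradient image\<close>

theorem theorem3p34:
  fixes X E :: "(real ^ 'n) set" and u :: "real ^ 'n \<Rightarrow> real"
  assumes "open X"
    and "locally_semiconvex_on X u"
    and "E \<in> sets lebesgue"
    and "E \<subseteq> Diff2 X u"
  shows "Du u ` E \<in> sets lebesgue \<and>
    emeasure lebesgue (Du u ` E) \<le> (\<integral>\<^sup>+x\<in>E. ennreal \<bar>det (D2u u x)\<bar> \<partial>lebesgue)"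
proof -
  have deriv: "(Du u has_derivative (*v) (D2u u x)) (at x within E)" if "x \<in> E" for x
    using Du_has_derivative[OF assms(2,4) that] .
  then have "Du u differentiable_on E"
    by (auto simp: differentiable_on_def differentiable_def)
  then have "Du u ` E \<in> sets lebesgue"
    using assms(3) by (intro differentiable_image_in_sets_lebesgue) auto
  moreover have "emeasure lebesgue (Du u ` E) \<le> (\<integral>\<^sup>+x\<in>E. ennreal \<bar>det (D2u u x)\<bar> \<partial>lebesgue)"
    using emeasure_differentiable_image[OF assms(3) deriv] by simp
  ultimately show ?thesis ..
qed

end
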